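(* Let $i_t(G)$ denote the number of independent sets of size $t$ in a graph $G$, and let $\mathcal{G}(n,\delta)$ denote the family of simple graphs on $n$ vertices with minimum degree exactly $\delta$. Let $K_{a,b}$ denote the complete bipartite graph with partite sets of sizes $a$ and $b$; note $i_t(K_{\delta,n-\delta})=\binom{n-\delta}{t}+\binom{\delta}{t}$. \begin{enumerate} \item For every $n$, every $t\ge 3$ and every $G\in\mathcal{G}(n,2)$ we have $i_t(G)\le i_t(K_{2,n-2})$. Moreover, for $n\ge 5$ and $3\le t\le n-2$, equality holds if and only if $G=K_{2,n-2}$ or $G$ is the graph obtained from $K_{2,n-2}$ by adding the edge joining the two vertices in the partite set of size $2$. \item For every $n$, every $t\ge 3$ and every $G\in\mathcal{G}(n,3)$ we have $i_t(G)\le i_t(K_{3,n-3})$. Moreover, for $n\ge 6$ and $t=3$, equality holds if and only if $G=K_{3,n-3}$; and for $n\ge 7$ and $4\le t\le n-3$, equality holds if and only if $G$ is obtained from $K_{3,n-3}$ by adding some (possibly no) edges inside the partite set of size $3$. \item For $\delta\ge 3$, every $n$, every $t\ge 2\delta+1$ and every $G\in\mathcal{G}(n,\delta)$ we have $i_t(G)\le i_t(K_{\delta,n-\delta})$. Moreover, for $n\ge 3\delta+1$ and $2\delta+1\le t\le n-\delta$, equality holds if and only if $G$ is obtained from $K_{\delta,n-\delta}$ by adding some (possibly no) edges inside the partite set of size $\delta$. \end{enumerate}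
   Context: All graphs are finite, simple and loopless. An independent set is a set of vertices spanning no edges. *)

theory Defs
  imports "Graph_Theory.Graph_Theory"
begin

text \<open>
  A simple graph is a \<open>pair_graph\<close>: a finite, loop-free digraph whose arc set is a symmetric
  relation, so that an edge \<open>uv\<close> is the pair of arcs \<open>(u, v)\<close>, \<open>(v, u)\<close>. Consequently the degree
  of a vertex is its \<open>out_degree\<close>, and graph isomorphism is \<open>digraph_iso\<close>.
\<close>

definition independent_set :: "'a pair_pre_digraph \<Rightarrow> 'a set \<Rightarrow> bool" where
  "independent_set G S \<longleftrightarrow> S \<subseteq> pverts G \<and> (\<forall>u\<in>S. \<forall>v\<in>S. (u, v) \<notin> parcs G)"

definition num_indep :: "nat \<Rightarrow> 'a pair_pre_digraph \<Rightarrow> nat" where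
  "num_indep t G = card {S. independent_set G S \<and> card S = t}"

definition min_degree :: "'a pair_pre_digraph \<Rightarrow> nat" where
  "min_degree G = Min (out_degree (with_proj G) ` pverts G)"

text \<open>
  Non-emptiness is required because \<open>Min {}\<close> is unspecified, so that \<open>min_degree\<close> says nothing
  about the graph without vertices.
\<close>

definition graph_family :: "nat \<Rightarrow> nat \<Rightarrow> 'a pair_pre_digraph set" where
  "graph_family n \<delta> =
    {G. pair_graph G \<and> pverts G \<noteq> {} \<and> card (pverts G) = n \<and> min_degree G = \<delta>}"

definition left_part :: "nat \<Rightarrow> (nat + nat) set" where
  "left_part a = Inl ` {..<a}"

definition right_part :: "nat \<Rightarrow> (nat + nat) set" where
  "right_part b = Inr ` {..<b}"

definition complete_bipartite :: "nat \<Rightarrow> nat \<Rightarrow> (nat + nat) pair_pre_digraph" where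
  "complete_bipartite a b =
    \<lparr> pverts = left_part a \<union> right_part b,
      parcs = left_part a \<times> right_part b \<union> right_part b \<times> left_part a \<rparr>"

definition add_edges :: "'a pair_pre_digraph \<Rightarrow> 'a rel \<Rightarrow> 'a pair_pre_digraph" where
  "add_edges G F = G \<lparr> parcs := parcs G \<union> F \<union> F\<inverse> \<rparr>"

definition graph_iso :: "'a pair_pre_digraph \<Rightarrow> 'b pair_pre_digraph \<Rightarrow> bool" where
  "graph_iso G H \<longleftrightarrow> digraph_iso (with_proj G) (with_proj H)"

definition bipartite_plus_left_edges :: "nat \<Rightarrow> nat \<Rightarrow> 'a pair_pre_digraph \<Rightarrow> bool" where
  "bipartite_plus_left_edges a b G \<longleftrightarrow>
    (\<exists>F. F \<subseteq> left_part a \<times> left_part a - Id \<and> graph_iso G (add_edges (complete_bipartite a b) F))"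

lemma finite_parts [simp]: "finite (left_part a)" "finite (right_part b)"
  by (simp_all add: left_part_def right_part_def)

lemma card_parts [simp]: "card (left_part a) = a" "card (right_part b) = b"
  by (simp_all add: left_part_def right_part_def card_image)

lemma parts_disjoint: "left_part a \<inter> right_part b = {}"
  by (auto simp: left_part_def right_part_def)

lemma complete_bipartite_is_complete_bipartite_digraph:
  "complete_bipartite_digraph a b (with_proj (complete_bipartite a b))"
  unfolding complete_bipartite_digraph_pair_def complete_bipartite_def
  by (simp, rule exI[of _ "left_part a"], rule exI[of _ "right_part b"])
    (simp add: parts_disjoint)

lemma independent_set_complete_bipartite:
  "independent_set (complete_bipartite a b) S \<longleftrightarrow> S \<subseteq> left_part a \<or> S \<subseteq> right_part b"
proof
  assume *: "independent_set (complete_bipartite a b) S"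
  have sub: "S \<subseteq> left_part a \<union> right_part b"
    using * unfolding independent_set_def complete_bipartite_def by simp
  have ind: "\<not> (u \<in> left_part a \<and> v \<in> right_part b)" if "u \<in> S" "v \<in> S" for u v
  proof -
    have "(u, v) \<notin> parcs (complete_bipartite a b)"
      using * that unfolding independent_set_def by blast
    then show ?thesis unfolding complete_bipartite_def by simp
  qed
  show "S \<subseteq> left_part a \<or> S \<subseteq> right_part b"
  proof (cases "S \<subseteq> left_part a")
    case False
    then obtain x where "x \<in> S" "x \<notin> left_part a" by blast
    with sub have "x \<in> right_part b" by blast
    with ind \<open>x \<in> S\<close> sub have "S \<subseteq> right_part b" by blast
    then show ?thesis ..
  qed simp
next
  have nr: "u \<notin> right_part b" if "u \<in> left_part a" for u
    using that by (auto simp: left_part_def right_part_def)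
  assume "S \<subseteq> left_part a \<or> S \<subseteq> right_part b"
  then show "independent_set (complete_bipartite a b) S"
  proof
    assume "S \<subseteq> left_part a"
    from subsetD[OF this] nr show ?thesis
      unfolding independent_set_def complete_bipartite_def by (simp add: subset_iff)
  next
    assume "S \<subseteq> right_part b"
    from subsetD[OF this] nr show ?thesis
      unfolding independent_set_def complete_bipartite_def by (auto simp: subset_iff)
  qed
qed

lemma num_indep_complete_bipartite:
  assumes "t \<ge> 1"
  shows "num_indep t (complete_bipartite a b) = (b choose t) + (a choose t)"
proof -
  let ?A = "{S. S \<subseteq> left_part a \<and> card S = t}" and ?B = "{S. S \<subseteq> right_part b \<and> card S = t}"
  have "S \<notin> ?B" if "S \<in> ?A" for S
  proof
    assume "S \<in> ?B"
    with that have "S \<subseteq> left_part a \<inter> right_part b" by simp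
    then have "S = {}" by (simp add: parts_disjoint)
    with that assms show False by simp
  qed
  then have "?A \<inter> ?B = {}" by (simp only: disjoint_iff) simp
  moreover have "finite ?A" "finite ?B"
    by simp_all
  ultimately have "card (?A \<union> ?B) = card ?A + card ?B"
    by (intro card_Un_disjoint)
  moreover have "{S. independent_set (complete_bipartite a b) S \<and> card S = t} = ?A \<union> ?B"
    by (auto simp: independent_set_complete_bipartite)
  ultimately show ?thesis
    by (simp add: num_indep_def n_subsets)
qed

end

theory Submission
  imports Defs
begin

text \<open>
  Write \<open>n\<close> for the number of vertices, \<open>d\<close> for the minimum degree and \<open>i\<^sub>t\<close> for the number
  of independent \<open>t\<close>-sets. An independent \<open>t\<close>-set has at least \<open>d\<close> neighbours, so
  \<open>(t + 1) i\<^sub>t\<^sub>+\<^sub>1 \<le> (n - d - t) i\<^sub>t\<close>; hence the bound \<open>i\<^sub>t \<le> (n - d choose t)\<close>, together with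
  its equality case, propagates from one value of \<open>t\<close> to all larger ones.

  For \<open>t = 2 d + 1\<close>, use induction on \<open>n\<close>. If a vertex can be deleted without the minimum
  degree dropping below \<open>d\<close>, Pascal's rule gives the bound. Otherwise \<open>d + 1\<close> independent
  vertices never share the same \<open>d\<close> neighbours, since each of them could be deleted, so they
  have at least \<open>d + 1\<close> neighbours, and the resulting gain in the last \<open>d\<close> steps outweighs
  the freedom in choosing the first vertex.

  For \<open>t = 3\<close> and \<open>d \<le> 3\<close>, a vertex of degree at least \<open>n - d\<close> lies in at most
  \<open>(d - 1 choose 2)\<close> independent triples, and deleting it leads to the case \<open>d - 1\<close>. If all
  degrees are between \<open>d\<close> and \<open>n - 1 - d\<close>, Goodman's count of triples is strictly sufficient.
\<close>

section \<open>Binomial coefficients\<close>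

lemma Suc_times_choose_Suc: "Suc k * (m choose Suc k) = (m choose k) * (m - k)"
  by (metis binomial_absorb_comp binomial_absorption mult.commute)

text \<open>Pascal's rule splits off a positive summand from \<open>n choose k\<close> and leaves a
  binomial that still dominates \<open>m choose k\<close>.\<close>

lemma choose_strict_mono_left:
  assumes "m < n" "1 \<le> k" "k \<le> n"
  shows "m choose k < n choose k"
proof -
  obtain n' k' where nk: "n = Suc n'" "k = Suc k'"
    using assms by (cases n; cases k) auto
  then have "0 < n' choose k'" "m choose k \<le> n' choose k"
    using assms by (auto intro: binomial_right_mono)
  then show ?thesis unfolding nk binomial_Suc_Suc by linarith
qed

text \<open>Clears the denominator, so that comparing counts of triples becomes polynomial
  arithmetic.\<close>

lemma choose_3_times_6: "6 * (n choose 3) = n * (n - 1) * (n - 2)"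
proof -
  have "3 * (n choose 3) = (n choose 2) * (n - 2)" "2 * (n choose 2) = n * (n - 1)"
    using Suc_times_choose_Suc[of 2 n] Suc_times_choose_Suc[of 1 n]
    by (simp_all add: numeral_2_eq_2[symmetric])
  moreover have "6 * (n choose 3) = 2 * (3 * (n choose 3))" by simp
  ultimately show ?thesis by (metis mult.assoc)
qed

section \<open>Independent sets relative to a vertex set\<close>

locale adjacency =
  fixes E :: "'a rel"
  assumes sym: "sym E" and irrefl: "irrefl E"
begin

text \<open>All notions take the vertex set \<open>V\<close> as a parameter while \<open>E\<close>
  stays fixed, so that deleting a vertex simply means passing to \<open>V - {a}\<close>.\<close>

definition nbrs :: "'a set \<Rightarrow> 'a \<Rightarrow> 'a set" where
  "nbrs V v = {u \<in> V. (v, u) \<in> E}"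

definition edge_free :: "'a set \<Rightarrow> bool" where
  "edge_free S \<longleftrightarrow> (\<forall>u\<in>S. \<forall>v\<in>S. (u, v) \<notin> E)"

definition indep_sets :: "'a set \<Rightarrow> nat \<Rightarrow> 'a set set" where
  "indep_sets V t = {S. S \<subseteq> V \<and> card S = t \<and> edge_free S}"

text \<open>A lower bound instead of the exact minimum: deleting a vertex lowers such a bound by at
  most one, whatever happens to the minimum itself.\<close>

definition min_deg_ge :: "'a set \<Rightarrow> nat \<Rightarrow> bool" where
  "min_deg_ge V d \<longleftrightarrow> (\<forall>v\<in>V. d \<le> card (nbrs V v))"

lemma adj_sym: "(u, v) \<in> E \<longleftrightarrow> (v, u) \<in> E"
  using sym by (auto simp: sym_def)

lemma adj_irrefl [simp]: "(v, v) \<notin> E"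
  using irrefl by (simp add: irrefl_def)

lemma nbrs_subset: "nbrs V v \<subseteq> V"
  by (auto simp: nbrs_def)

lemma finite_nbrs: "finite V \<Longrightarrow> finite (nbrs V v)"
  by (simp add: nbrs_def)

lemma finite_indep_sets: "finite V \<Longrightarrow> finite (indep_sets V t)"
  by (rule finite_subset[of _ "Pow V"]) (auto simp: indep_sets_def)

lemma edge_free_subset: "edge_free S \<Longrightarrow> T \<subseteq> S \<Longrightarrow> edge_free T"
  by (auto simp: edge_free_def)

lemma edge_free_insert:
  "edge_free (insert x S) \<longleftrightarrow> edge_free S \<and> (\<forall>y\<in>S. (x, y) \<notin> E)"
  using adj_sym by (auto simp: edge_free_def)

lemma indep_sets_le_choose: "finite V \<Longrightarrow> card (indep_sets V t) \<le> card V choose t"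
  unfolding n_subsets[symmetric, of V t]
  by (rule card_mono) (auto simp: indep_sets_def)

text \<open>Equality makes every \<open>t\<close>-subset independent, and any two vertices lie in a
  common \<open>t\<close>-subset.\<close>

lemma edge_free_if_indep_sets_eq_choose:
  assumes fin: "finite V" and t: "2 \<le> t" "t \<le> card V"
    and eq: "card (indep_sets V t) = card V choose t"
  shows "edge_free V"
proof -
  have all: "indep_sets V t = {S. S \<subseteq> V \<and> card S = t}"
    by (rule card_subset_eq) (use fin eq n_subsets[OF fin] in \<open>auto simp: indep_sets_def\<close>)
  have "(u, v) \<notin> E" if uv: "u \<in> V" "v \<in> V" for u v
  proof (cases "u = v")
    case False
    then have "card {u, v} \<le> t" "{u, v} \<subseteq> V"
      using uv t by auto
    then obtain S where "{u, v} \<subseteq> S" "S \<subseteq> V" "card S = t"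
      using exists_subset_between[of "{u, v}" t V] t fin by auto
    with all have "S \<in> indep_sets V t" "u \<in> S" "v \<in> S" by auto
    then show ?thesis by (auto simp: indep_sets_def edge_free_def)
  qed simp
  then show ?thesis by (auto simp: edge_free_def)
qed

section \<open>Counting by deletion and by extension\<close>

lemma card_non_nbrs:
  assumes "finite V" "a \<in> V"
  shows "card (V - {a} - nbrs V a) = card V - 1 - card (nbrs V a)"
proof -
  have "nbrs V a \<subseteq> V - {a}" by (auto simp: nbrs_def)
  then show ?thesis using assms by (simp add: card_Diff_subset finite_nbrs)
qed

text \<open>An independent set either avoids \<open>a\<close>, or it is \<open>a\<close> together
  with an independent set among the non-neighbours of \<open>a\<close>.\<close>

lemma card_indep_sets_delete:
  assumes fin: "finite V" and a: "a \<in> V"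
  shows "card (indep_sets V (Suc t)) =
    card (indep_sets (V - {a}) (Suc t)) + card (indep_sets (V - {a} - nbrs V a) t)"
proof -
  let ?W = "V - {a} - nbrs V a"
  have split: "indep_sets V (Suc t) = indep_sets (V - {a}) (Suc t) \<union> insert a ` indep_sets ?W t"
    (is "?L = ?R1 \<union> ?R2")
  proof (intro equalityI subsetI)
    fix S assume S: "S \<in> ?L"
    show "S \<in> ?R1 \<union> ?R2"
    proof (cases "a \<in> S")
      case True
      have "finite S" using S fin by (auto simp: indep_sets_def intro: finite_subset)
      then have "S - {a} \<in> indep_sets ?W t"
        using S True by (auto simp: indep_sets_def edge_free_def nbrs_def)
      moreover have "S = insert a (S - {a})" using True by auto
      ultimately show ?thesis by blast
    qed (use S in \<open>auto simp: indep_sets_def\<close>)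
  next
    fix S assume "S \<in> ?R1 \<union> ?R2"
    then show "S \<in> ?L"
    proof
      assume "S \<in> ?R2"
      then obtain T where T: "T \<in> indep_sets ?W t" "S = insert a T" by auto
      then have "finite T" "a \<notin> T" using fin by (auto simp: indep_sets_def intro: finite_subset)
      then show ?thesis using T a by (auto simp: indep_sets_def edge_free_insert nbrs_def)
    qed (auto simp: indep_sets_def)
  qed
  have inj: "inj_on (insert a) (indep_sets ?W t)"
    by (rule inj_onI) (auto simp: indep_sets_def insert_ident subset_iff)
  show ?thesis
    unfolding split
    by (subst card_Un_disjoint)
      (use fin inj in \<open>auto simp: finite_indep_sets card_image indep_sets_def\<close>)
qed

lemma card_indep_sets_delete_le:
  assumes "finite V" "a \<in> V"
  shows "card (indep_sets V (Suc t)) \<le>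
    card (indep_sets (V - {a}) (Suc t)) + ((card V - 1 - card (nbrs V a)) choose t)"
  using card_indep_sets_delete[OF assms, of t] assms
    indep_sets_le_choose[of "V - {a} - nbrs V a" t]
  by (simp add: card_non_nbrs)

text \<open>These are the vertices by which \<open>I\<close> can be extended; \<open>I\<close> and
  its neighbourhood are disjoint, so their sizes are subtracted separately.\<close>

lemma card_non_closed_nbhd:
  assumes fin: "finite V" and I: "I \<in> indep_sets V t"
  shows "card (V - I - (\<Union>x\<in>I. nbrs V x)) = card V - t - card (\<Union>x\<in>I. nbrs V x)"
proof -
  have "(\<Union>x\<in>I. nbrs V x) \<subseteq> V - I" "I \<subseteq> V" "card I = t"
    using I by (auto simp: indep_sets_def edge_free_def nbrs_def)
  with fin show ?thesis by (simp add: card_Diff_subset finite_subset[of _ V] finite_subset[of _ "V - I"])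
qed

text \<open>By double counting the pairs of an independent \<open>(t + 1)\<close>-set and one of its elements.\<close>

lemma card_indep_sets_Suc:
  assumes fin: "finite V"
  shows "Suc t * card (indep_sets V (Suc t)) =
    (\<Sum>I\<in>indep_sets V t. card V - t - card (\<Union>x\<in>I. nbrs V x))"
proof -
  let ?P = "SIGMA J:indep_sets V (Suc t). J"
  let ?Q = "SIGMA I:indep_sets V t. V - I - (\<Union>x\<in>I. nbrs V x)"
  have finm: "finite S" if "S \<in> indep_sets V k" for S k
    using that fin by (auto simp: indep_sets_def intro: finite_subset)
  have "card ?P = (\<Sum>J\<in>indep_sets V (Suc t). card J)"
    by (rule card_SigmaI) (use fin finm finite_indep_sets in auto)
  also have "\<dots> = (\<Sum>J\<in>indep_sets V (Suc t). Suc t)"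
    by (rule sum.cong) (auto simp: indep_sets_def)
  finally have P: "card ?P = Suc t * card (indep_sets V (Suc t))" by simp
  have "bij_betw (\<lambda>(J, v). (J - {v}, v)) ?P ?Q"
  proof (rule bij_betwI[where g = "\<lambda>(I, v). (insert v I, v)"])
    show "(\<lambda>(J, v). (J - {v}, v)) \<in> ?P \<rightarrow> ?Q"
      using finm by (fastforce simp: indep_sets_def edge_free_def nbrs_def)
    show "(\<lambda>(I, v). (insert v I, v)) \<in> ?Q \<rightarrow> ?P"
    proof (intro Pi_I)
      fix p assume "p \<in> ?Q"
      then obtain I v where p: "p = (I, v)" "I \<in> indep_sets V t" "v \<in> V" "v \<notin> I"
        "\<And>x. x \<in> I \<Longrightarrow> v \<notin> nbrs V x" by auto
      then have "(v, x) \<notin> E" if "x \<in> I" for x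
        using that adj_sym by (auto simp: nbrs_def)
      with p finm[OF p(2)] have "insert v I \<in> indep_sets V (Suc t)"
        by (auto simp: indep_sets_def edge_free_insert)
      then show "(case p of (I, v) \<Rightarrow> (insert v I, v)) \<in> ?P" by (simp add: p)
    qed
  qed auto
  then have "card ?P = card ?Q" by (rule bij_betw_same_card)
  also have "\<dots> = (\<Sum>I\<in>indep_sets V t. card (V - I - (\<Union>x\<in>I. nbrs V x)))"
    by (rule card_SigmaI) (use fin finite_indep_sets in auto)
  also have "\<dots> = (\<Sum>I\<in>indep_sets V t. card V - t - card (\<Union>x\<in>I. nbrs V x))"
    by (rule sum.cong) (simp_all add: card_non_closed_nbhd fin)
  finally show ?thesis using P by simp
qed

text \<open>The form in which the double count is applied: with \<open>c = d\<close> in general, and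
  with \<open>c = Suc d\<close> when no vertex can be deleted.\<close>

lemma card_indep_sets_Suc_le:
  assumes fin: "finite V"
    and exp: "\<And>I. I \<in> indep_sets V t \<Longrightarrow> c \<le> card (\<Union>x\<in>I. nbrs V x)"
  shows "Suc t * card (indep_sets V (Suc t)) \<le> card (indep_sets V t) * (card V - t - c)"
  unfolding card_indep_sets_Suc[OF fin]
  using sum_bounded_above[of "indep_sets V t" "\<lambda>I. card V - t - card (\<Union>x\<in>I. nbrs V x)"
      "card V - t - c"] exp
  by (simp add: diff_le_mono2)

lemma card_nbhd_ge:
  assumes fin: "finite V" and deg: "min_deg_ge V d"
    and I: "I \<in> indep_sets V t" and t: "1 \<le> t"
  shows "d \<le> card (\<Union>x\<in>I. nbrs V x)"
proof -
  obtain x where x: "x \<in> I" "x \<in> V"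
    using I t by (cases "I = {}") (auto simp: indep_sets_def)
  have "finite (\<Union>x\<in>I. nbrs V x)"
    by (rule finite_subset[OF _ fin]) (auto simp: nbrs_def)
  then have "card (nbrs V x) \<le> card (\<Union>x\<in>I. nbrs V x)"
    by (rule card_mono) (use x in auto)
  then show ?thesis using deg x by (auto simp: min_deg_ge_def intro: order_trans)
qed

text \<open>\<open>I\<close> and its at least \<open>d\<close> neighbours are disjoint inside
  \<open>V\<close>. Read contrapositively, graphs with too few vertices have no independent
  \<open>t\<close>-sets at all.\<close>

lemma card_ge_if_indep_set:
  assumes fin: "finite V" and deg: "min_deg_ge V d"
    and I: "I \<in> indep_sets V t" and t: "1 \<le> t"
  shows "t + d \<le> card V"
proof -
  have disj: "I \<inter> (\<Union>x\<in>I. nbrs V x) = {}" and sub: "I \<union> (\<Union>x\<in>I. nbrs V x) \<subseteq> V" and "card I = t"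
    using I by (auto simp: indep_sets_def edge_free_def nbrs_def)
  have "t + d \<le> card I + card (\<Union>x\<in>I. nbrs V x)"
    using card_nbhd_ge[OF assms] \<open>card I = t\<close> by simp
  also have "\<dots> = card (I \<union> (\<Union>x\<in>I. nbrs V x))"
    by (rule card_Un_disjoint[symmetric]) (use disj sub fin in \<open>auto intro: finite_subset\<close>)
  also have "\<dots> \<le> card V" using sub fin by (rule card_mono[rotated])
  finally show ?thesis .
qed

section \<open>Vertex deletion and large edge-free sets\<close>

lemma min_deg_ge_delete:
  assumes fin: "finite V" and deg: "min_deg_ge V (Suc d)"
  shows "min_deg_ge (V - {a}) d"
  unfolding min_deg_ge_def
proof
  fix v assume v: "v \<in> V - {a}"
  have "nbrs (V - {a}) v = nbrs V v - {a}" by (auto simp: nbrs_def)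
  moreover have "Suc d \<le> card (nbrs V v)" using deg v by (auto simp: min_deg_ge_def)
  moreover have "card (nbrs V v) - 1 \<le> card (nbrs V v - {a})"
    using card_Diff1_le by (simp add: card_Diff_singleton_if)
  ultimately show "d \<le> card (nbrs (V - {a}) v)" by simp
qed

text \<open>Neighbours of \<open>b\<close> can only lie in \<open>V - B\<close>, which has just
  \<open>d\<close> elements. Thus \<open>B\<close> is completely joined to its complement, which is
  why the extremal structure is always delivered as an edge-free set of \<open>card V - d\<close>
  vertices.\<close>

lemma nbrs_eq_Diff:
  assumes fin: "finite V" and deg: "min_deg_ge V d"
    and B: "B \<subseteq> V" "edge_free B" "card B = card V - d" and d: "d \<le> card V" and b: "b \<in> B"
  shows "nbrs V b = V - B"
proof (rule card_subset_eq)
  show sub: "nbrs V b \<subseteq> V - B" using B b by (auto simp: nbrs_def edge_free_def)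
  have "card (V - B) = d" using B fin d by (simp add: card_Diff_subset finite_subset)
  moreover have "card (nbrs V b) \<le> card (V - B)" using sub fin by (intro card_mono) auto
  moreover have "d \<le> card (nbrs V b)" using deg b B by (auto simp: min_deg_ge_def)
  ultimately show "card (nbrs V b) = card (V - B)" by simp
qed (use fin in simp)

text \<open>Every vertex outside \<open>B\<close> is adjacent to all of \<open>B\<close>, so an
  independent set cannot meet both \<open>B\<close> and \<open>V - B\<close>.\<close>

lemma indep_sets_le_if_edge_free:
  assumes fin: "finite V" and deg: "min_deg_ge V d"
    and B: "B \<subseteq> V" "edge_free B" "card B = card V - d" and d: "d \<le> card V"
  shows "card (indep_sets V t) \<le> ((card V - d) choose t) + card (indep_sets (V - B) t)"
proof -
  have "indep_sets V t \<subseteq> {S. S \<subseteq> B \<and> card S = t} \<union> indep_sets (V - B) t"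
  proof
    fix S assume S: "S \<in> indep_sets V t"
    have "S \<subseteq> V - B" if "b \<in> S \<inter> V" "b \<notin> B"  for b
    proof -
      have "(x, b) \<in> E" if "x \<in> B" for x
        using nbrs_eq_Diff[OF assms that] \<open>b \<in> S \<inter> V\<close> \<open>b \<notin> B\<close> by (auto simp: nbrs_def)
      with S that show ?thesis by (auto simp: indep_sets_def edge_free_def)
    qed
    with S show "S \<in> {S. S \<subseteq> B \<and> card S = t} \<union> indep_sets (V - B) t"
      by (auto simp: indep_sets_def)
  qed
  moreover have finB: "finite B" using B(1) fin by (rule finite_subset)
  ultimately have "card (indep_sets V t) \<le> card ({S. S \<subseteq> B \<and> card S = t} \<union> indep_sets (V - B) t)"
    by (intro card_mono) (auto simp: fin finite_indep_sets)
  also have "\<dots> \<le> card {S. S \<subseteq> B \<and> card S = t} + card (indep_sets (V - B) t)"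
    by (rule card_Un_le)
  finally show ?thesis using finB B by (simp add: n_subsets)
qed

section \<open>Propagation of the bound to larger sets\<close>

text \<open>The ratio \<open>(n - d - t) / (t + 1)\<close> from the double count is exactly the
  ratio of consecutive binomial coefficients.\<close>

lemma indep_sets_Suc_le_choose:
  assumes fin: "finite V" and deg: "min_deg_ge V d" and t: "1 \<le> t"
    and le: "card (indep_sets V t) \<le> (card V - d) choose t"
  shows "card (indep_sets V (Suc t)) \<le> (card V - d) choose Suc t"
proof -
  have "Suc t * card (indep_sets V (Suc t)) \<le> card (indep_sets V t) * (card V - t - d)"
    using card_indep_sets_Suc_le[OF fin] card_nbhd_ge[OF fin deg] t by blast
  also have "\<dots> \<le> ((card V - d) choose t) * (card V - d - t)"
    using le by (simp add: add.commute)
  also have "\<dots> = Suc t * ((card V - d) choose Suc t)"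
    by (rule Suc_times_choose_Suc[symmetric])
  finally show ?thesis by (simp only: mult_le_cancel1)
qed

text \<open>Equality forces every independent \<open>t\<close>-set to have exactly \<open>d\<close> neighbours. Exchanging one
  vertex of such a set then shows that all vertices outside these neighbours have the same
  neighbourhood.\<close>

lemma edge_free_if_indep_sets_Suc_eq_choose:
  assumes fin: "finite V" and deg: "min_deg_ge V d" and t: "2 \<le> t"
    and le: "card (indep_sets V t) \<le> (card V - d) choose t"
    and n: "Suc t \<le> card V - d"
    and ge: "(card V - d) choose Suc t \<le> card (indep_sets V (Suc t))"
  obtains B where "B \<subseteq> V" "edge_free B" "card B = card V - d"
proof -
  let ?N = "\<lambda>I. \<Union>x\<in>I. nbrs V x"
  have tight: "card (?N I) = d" if I: "I \<in> indep_sets V t" for I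
  proof (rule ccontr)
    assume "card (?N I) \<noteq> d"
    then have gt: "d < card (?N I)" using card_nbhd_ge[OF fin deg I] t by simp
    have "(\<Sum>I\<in>indep_sets V t. card V - t - card (?N I)) < (\<Sum>I\<in>indep_sets V t. card V - t - d)"
    proof (rule sum_strict_mono_ex1)
      show "\<forall>I\<in>indep_sets V t. card V - t - card (?N I) \<le> card V - t - d"
        using card_nbhd_ge[OF fin deg] t by (auto intro: diff_le_mono2)
      \<comment> \<open>By \<open>n\<close> the number \<open>card V - t - d\<close> is positive, so
        an extra neighbour really lowers the truncated difference.\<close>
      show "\<exists>I\<in>indep_sets V t. card V - t - card (?N I) < card V - t - d"
        using I gt n by (intro bexI[of _ I]) auto
    qed (simp add: finite_indep_sets fin)
    then have "Suc t * card (indep_sets V (Suc t)) < card (indep_sets V t) * (card V - d - t)"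
      by (simp add: card_indep_sets_Suc[OF fin] add.commute del: mult_Suc)
    also have "\<dots> \<le> ((card V - d) choose t) * (card V - d - t)" using le by simp
    also have "\<dots> = Suc t * ((card V - d) choose Suc t)"
      by (rule Suc_times_choose_Suc[symmetric])
    finally show False using ge by (simp only: mult_less_cancel1) simp
  qed
  have "0 < Suc t * card (indep_sets V (Suc t))" using ge n
    by (metis binomial_eq_0_iff gr0I leD le_zero_eq mult_is_0 nat.distinct(1))
  then have "indep_sets V t \<noteq> {}"
    unfolding card_indep_sets_Suc[OF fin] by auto
  then obtain I where I: "I \<in> indep_sets V t" by auto
  have finI: "finite I" using I fin by (auto simp: indep_sets_def intro: finite_subset)
  have nb: "nbrs V x = ?N J" if "J \<in> indep_sets V t" "x \<in> J" for J x
  proof (rule card_subset_eq)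
    show "finite (?N J)" by (rule finite_subset[OF _ fin]) (auto simp: nbrs_def)
    then have "card (nbrs V x) \<le> card (?N J)" using that by (intro card_mono) auto
    then show "card (nbrs V x) = card (?N J)"
      using tight[OF that(1)] deg that by (auto simp: min_deg_ge_def indep_sets_def intro: antisym)
  qed (use that in auto)
  have "2 \<le> card I" using I t by (simp add: indep_sets_def)
  then obtain x y where xy: "x \<in> I" "y \<in> I" "x \<noteq> y"
    by (metis card_2_iff' obtain_subset_with_card_n subset_iff)
  have out: "nbrs V w = ?N I" if w: "w \<in> V - ?N I" for w
  proof (cases "w \<in> I")
    case False
    have ne: "(w, z) \<notin> E" if "z \<in> I" for z
      using w that adj_sym by (auto simp: nbrs_def)
    \<comment> \<open>The vertex \<open>x\<close> survives the exchange of \<open>y\<close> for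
      \<open>w\<close>; as a common member it identifies the neighbourhood of the new set with that
      of \<open>I\<close>.\<close>
    have "insert w (I - {y}) \<in> indep_sets V t"
      using I finI w False xy ne t
      by (auto simp: indep_sets_def edge_free_insert intro: edge_free_subset)
    from nb[OF this, of w] nb[OF this, of x] nb[OF I, of x] xy show ?thesis by simp
  qed (rule nb[OF I])
  show ?thesis
  proof (rule that)
    show "edge_free (V - ?N I)"
      unfolding edge_free_def
    proof (intro ballI)
      fix u v assume uv: "u \<in> V - ?N I" "v \<in> V - ?N I"
      then have "v \<notin> nbrs V u" using out[OF uv(1)] by simp
      with uv show "(u, v) \<notin> E" by (simp add: nbrs_def)
    qed
    have "?N I \<subseteq> V" by (auto simp: nbrs_def)
    then show "card (V - ?N I) = card V - d"
      using tight[OF I] fin by (simp add: card_Diff_subset finite_subset)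
  qed auto
qed

lemma indep_sets_le_choose_mono:
  assumes fin: "finite V" and deg: "min_deg_ge V d" and t0: "1 \<le> t0" "t0 \<le> t"
    and le: "card (indep_sets V t0) \<le> (card V - d) choose t0"
  shows "card (indep_sets V t) \<le> (card V - d) choose t"
  using t0(2)
proof (induction t rule: dec_induct)
  case (step t)
  then show ?case using indep_sets_Suc_le_choose[OF fin deg] t0 by simp
qed (rule le)

subsection \<open>Large independent sets\<close>

text \<open>With only \<open>d\<close> neighbours, all members of \<open>I\<close> share the same
  neighbourhood. Any \<open>x\<close> in \<open>I\<close> could then be deleted: a vertex of that
  neighbourhood keeps the other \<open>t - 1 \<ge> d\<close> members of \<open>I\<close>, and every
  other vertex loses nothing.\<close>

lemma card_nbhd_gt_if_no_deletable_vertex: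
  assumes fin: "finite V" and deg: "min_deg_ge V d"
    and crit: "\<And>x. x \<in> V \<Longrightarrow> \<not> min_deg_ge (V - {x}) d"
    and I: "I \<in> indep_sets V t" and t: "d < t"
  shows "Suc d \<le> card (\<Union>x\<in>I. nbrs V x)"
proof (rule ccontr)
  let ?N = "\<Union>x\<in>I. nbrs V x"
  assume "\<not> Suc d \<le> card ?N"
  then have le: "card ?N \<le> d" by simp
  have IV: "I \<subseteq> V" "card I = t" "edge_free I" using I by (auto simp: indep_sets_def)
  have "finite ?N" by (rule finite_subset[OF _ fin]) (auto simp: nbrs_def)
  then have nb: "nbrs V x = ?N" if "x \<in> I" for x
    using that IV deg le by (intro card_seteq) (auto simp: min_deg_ge_def intro: order_trans)
  obtain x where x: "x \<in> I" using IV t by (cases "I = {}") auto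
  have "d \<le> card (nbrs (V - {x}) w)" if w: "w \<in> V - {x}" for w
  proof (cases "w \<in> ?N")
    case True
    then have "(y, w) \<in> E" if "y \<in> I" for y
      using nb[OF that] by (auto simp: nbrs_def)
    then have "I - {x} \<subseteq> nbrs (V - {x}) w"
      using IV adj_sym by (auto simp: nbrs_def)
    then have "card (I - {x}) \<le> card (nbrs (V - {x}) w)"
      using fin by (intro card_mono) (auto simp: finite_nbrs)
    then show ?thesis using x t IV finite_subset[OF IV(1) fin] by simp
  next
    case False
    then have "(w, x) \<notin> E" using nb[OF x] w adj_sym by (auto simp: nbrs_def)
    then have "nbrs (V - {x}) w = nbrs V w" by (auto simp: nbrs_def)
    then show ?thesis using deg w by (simp add: min_deg_ge_def)
  qed
  then have "min_deg_ge (V - {x}) d" by (simp add: min_deg_ge_def)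
  then show False using crit x IV by auto
qed

text \<open>Iterates the ratio bound from \<open>t = 1\<close>. Only the first vertex, with
  \<open>card V\<close> instead of \<open>card V - d\<close> choices, costs the factor
  \<open>n / (n - d)\<close>; it is cleared here to stay within the natural numbers.\<close>

lemma indep_sets_times_le_choose:
  assumes fin: "finite V" and deg: "min_deg_ge V d" and t: "1 \<le> t"
  shows "card (indep_sets V t) * (card V - d) \<le> card V * ((card V - d) choose t)"
  using t
proof (induction t rule: nat_induct_at_least)
  case base
  show ?case using indep_sets_le_choose[OF fin, of 1] by simp
next
  case (Suc t)
  let ?m = "card V - d"
  have "Suc t * card (indep_sets V (Suc t)) \<le> card (indep_sets V t) * (card V - t - d)"
    using card_indep_sets_Suc_le[OF fin] card_nbhd_ge[OF fin deg] Suc(1) by blast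
  also have "card V - t - d = ?m - t" by simp
  finally have "Suc t * card (indep_sets V (Suc t)) * ?m \<le> card (indep_sets V t) * (?m - t) * ?m"
    by (rule mult_right_mono) simp
  then have "Suc t * (card (indep_sets V (Suc t)) * ?m) \<le> (card (indep_sets V t) * ?m) * (?m - t)"
    by (simp only: ac_simps)
  also have "\<dots> \<le> card V * (?m choose t) * (?m - t)"
    using Suc.IH by (rule mult_right_mono) simp
  also have "\<dots> = Suc t * (card V * (?m choose Suc t))"
    by (metis Suc_times_choose_Suc mult.assoc mult.left_commute)
  finally show ?case by (simp only: mult_le_cancel1)
qed

text \<open>Once the independent sets have more than \<open>d\<close> vertices, each further vertex gains the
  factor \<open>(n - t - d - 1) / (n - t - d)\<close> over the bound for the complete bipartite graph, and
  the product telescopes.\<close>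

lemma indep_sets_le_if_no_deletable_vertex:
  assumes fin: "finite V" and deg: "min_deg_ge V d"
    and crit: "\<And>x. x \<in> V \<Longrightarrow> \<not> min_deg_ge (V - {x}) d"
  shows "card (indep_sets V (Suc d + s)) * ((card V - d) * (card V - d - Suc d)) \<le>
    card V * (card V - d - Suc d - s) * ((card V - d) choose (Suc d + s))"
proof (induction s)
  case 0
  show ?case
    using mult_right_mono[OF indep_sets_times_le_choose[OF fin deg, of "Suc d"], of "card V - d - Suc d"]
    by (simp add: ac_simps)
next
  case (Suc s)
  define t where "t = Suc d + s"
  let ?m = "card V - d"
  let ?X = "?m * (?m - Suc d)"
  have "Suc t * card (indep_sets V (Suc t)) \<le> card (indep_sets V t) * (card V - t - Suc d)"
  proof (rule card_indep_sets_Suc_le[OF fin])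
    fix I assume I: "I \<in> indep_sets V t"
    show "Suc d \<le> card (\<Union>x\<in>I. nbrs V x)"
      by (rule card_nbhd_gt_if_no_deletable_vertex[OF fin deg crit I]) (simp_all add: t_def)
  qed
  then have "Suc t * (card (indep_sets V (Suc t)) * ?X) \<le> (card (indep_sets V t) * ?X) * (card V - t - Suc d)"
    using mult_right_mono[of "Suc t * card (indep_sets V (Suc t))" "card (indep_sets V t) * (card V - t - Suc d)" ?X]
    by (simp only: ac_simps)
  also have "\<dots> \<le> (card V * (?m - t) * (?m choose t)) * (card V - t - Suc d)"
  proof -
    have "?m - Suc d - s = ?m - t" by (simp add: t_def)
    with Suc.IH show ?thesis by (intro mult_right_mono) (simp_all only: t_def)
  qed
  also have "\<dots> = card V * (card V - t - Suc d) * ((?m choose t) * (?m - t))"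
    by (simp only: ac_simps)
  \<comment> \<open>The telescoping: the old factor \<open>?m - t\<close> is absorbed into the
    binomial coefficient, and \<open>card V - t - Suc d\<close> takes its place.\<close>
  also have "\<dots> = Suc t * (card V * (card V - t - Suc d) * (?m choose Suc t))"
    by (metis Suc_times_choose_Suc mult.left_commute)
  finally have "card (indep_sets V (Suc t)) * ?X \<le> card V * (card V - t - Suc d) * (?m choose Suc t)"
    by (simp only: mult_le_cancel1)
  moreover have "card V - t - Suc d = ?m - Suc d - Suc s" by (simp add: t_def)
  ultimately show ?case by (simp add: t_def)
qed

text \<open>Equality can only occur when some vertex \<open>x\<close> is deletable. Both summands of
  Pascal's rule are then attained, and \<open>x\<close> with its non-neighbours is the edge-free
  set; without a deletable vertex the inequality is strict.\<close>

lemma indep_sets_two_min_deg_plus_one: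
  assumes fin: "finite V" and deg: "min_deg_ge V d" and d: "1 \<le> d" and n: "3 * d + 1 \<le> card V"
  shows "card (indep_sets V (2 * d + 1)) \<le> (card V - d) choose (2 * d + 1) \<and>
    (card (indep_sets V (2 * d + 1)) = (card V - d) choose (2 * d + 1) \<longrightarrow>
      (\<exists>B\<subseteq>V. edge_free B \<and> card B = card V - d))"
  using assms
proof (induction "card V" arbitrary: V rule: less_induct)
  case less
  define n where "n = card V"
  show ?case
  proof (cases "\<exists>x\<in>V. min_deg_ge (V - {x}) d")
    case True
    then obtain x where x: "x \<in> V" "min_deg_ge (V - {x}) d" by auto
    have cx: "card (V - {x}) = n - 1" using x less.prems by (simp add: n_def)
    have del: "card (indep_sets (V - {x}) (2 * d + 1)) \<le> (n - 1 - d) choose (2 * d + 1)"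
    proof (cases "3 * d + 1 \<le> n - 1")
      case True
      with less.hyps[of "V - {x}"] less.prems x show ?thesis
        by (simp add: cx n_def)
    next
      case False
      \<comment> \<open>Here \<open>n - 1 = 3 * d\<close>, one vertex short of the
        \<open>2 * d + 1\<close> members and their \<open>d\<close> neighbours.\<close>
      then have "indep_sets (V - {x}) (2 * d + 1) = {}"
        using card_ge_if_indep_set[OF _ x(2)] less.prems cx by fastforce
      then show ?thesis by simp
    qed
    let ?W = "V - {x} - nbrs V x"
    have dx: "d \<le> card (nbrs V x)" using less.prems x by (simp add: min_deg_ge_def)
    have cW: "card ?W = n - 1 - card (nbrs V x)"
      using card_non_nbrs less.prems x by (simp add: n_def)
    have cont: "card (indep_sets ?W (2 * d)) \<le> card ?W choose (2 * d)"
      using less.prems by (intro indep_sets_le_choose) auto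
    have mono: "card ?W choose (2 * d) \<le> (n - 1 - d) choose (2 * d)"
      using cW dx by (intro binomial_right_mono) auto
    have sum: "card (indep_sets V (2 * d + 1)) =
        card (indep_sets (V - {x}) (2 * d + 1)) + card (indep_sets ?W (2 * d))"
      using card_indep_sets_delete[OF less.prems(1) x(1), of "2 * d"] by simp
    have "n - d = Suc (n - 1 - d)" using less.prems(4) d by (simp add: n_def)
    then have pascal: "(n - d) choose (2 * d + 1) = ((n - 1 - d) choose (2 * d)) + ((n - 1 - d) choose (2 * d + 1))"
      by simp
    have "\<exists>B\<subseteq>V. edge_free B \<and> card B = n - d"
      if eq: "card (indep_sets V (2 * d + 1)) = (n - d) choose (2 * d + 1)"
    proof -
      have eqs: "card (indep_sets ?W (2 * d)) = card ?W choose (2 * d)"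
        "card ?W choose (2 * d) = (n - 1 - d) choose (2 * d)"
        using eq sum pascal del cont mono by linarith+
      \<comment> \<open>A larger degree would leave fewer non-neighbours and make the second summand
        strictly smaller.\<close>
      have "card (nbrs V x) = d"
      proof (rule ccontr)
        assume "card (nbrs V x) \<noteq> d"
        then have "card ?W < n - 1 - d" using cW dx less.prems(4) d by (simp add: n_def)
        then have "card ?W choose (2 * d) < (n - 1 - d) choose (2 * d)"
          using less.prems(4) d by (intro choose_strict_mono_left) (auto simp: n_def)
        then show False using eqs by simp
      qed
      then have cW': "card ?W = n - 1 - d" using cW by simp
      have "edge_free ?W"
        by (rule edge_free_if_indep_sets_eq_choose[OF _ _ _ eqs(1)])
          (use less.prems cW' n_def in auto)
      then have "edge_free (insert x ?W)"
        by (auto simp: edge_free_insert nbrs_def)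
      moreover have "card (insert x ?W) = n - d"
        using cW' less.prems by (simp add: n_def)
      ultimately show ?thesis using x by (intro exI[of _ "insert x ?W"]) auto
    qed
    then show ?thesis using sum pascal del cont mono by (auto simp: n_def)
  next
    case False
    let ?i = "card (indep_sets V (2 * d + 1))" and ?c = "(n - d) choose (2 * d + 1)"
    have nd: "3 * d + 1 \<le> n" using less.prems by (simp add: n_def)
    \<comment> \<open>The choice \<open>s = d\<close> turns \<open>Suc d + s\<close> into
      \<open>2 * d + 1\<close>.\<close>
    have bound: "?i * ((n - d) * (n - d - Suc d)) \<le> n * (n - d - Suc d - d) * ?c"
      using indep_sets_le_if_no_deletable_vertex[OF less.prems(1,2), of d] False
      by (auto simp: n_def mult_2)
    obtain k where k: "n = 3 * d + 1 + k" using nd le_Suc_ex by blast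
    \<comment> \<open>With \<open>n = 3 * d + 1 + k\<close> the right side exceeds the left by
      \<open>d * (2 * d + 1)\<close>, independently of \<open>k\<close>.\<close>
    have "n * (n - d - Suc d - d) < (n - d) * (n - d - Suc d)"
      using d by (simp add: k algebra_simps)
    moreover have "0 < ?c" using nd by simp
    ultimately have "n * (n - d - Suc d - d) * ?c < (n - d) * (n - d - Suc d) * ?c"
      by (simp only: mult_less_cancel2)
    with bound have "?i * ((n - d) * (n - d - Suc d)) < (n - d) * (n - d - Suc d) * ?c"
      by (rule le_less_trans)
    then have "?i < ?c" by (metis mult.commute mult_less_cancel2)
    then show ?thesis by (simp add: n_def)
  qed
qed

subsection \<open>Independent triples\<close>

text \<open>For a triple \<open>S\<close> this says that \<open>v\<close> is adjacent to exactly one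
  of the other two vertices.\<close>

definition mixed :: "'a \<Rightarrow> 'a set \<Rightarrow> bool" where
  "mixed v S \<longleftrightarrow> v \<in> S \<and> (\<exists>u\<in>S. (v, u) \<in> E) \<and> (\<exists>w\<in>S - {v}. (v, w) \<notin> E)"

text \<open>A vertex of a triple is mixed iff the two pairs containing it differ in adjacency. The
  truth values of the three pairs cannot be pairwise different.\<close>

lemma card_mixed_le:
  assumes "card S = 3"
  shows "card {v. mixed v S} \<le> 2"
proof -
  obtain a b c where S: "S = {a, b, c}" "a \<noteq> b" "b \<noteq> c" "a \<noteq> c"
    using assms by (auto simp: card_3_iff)
  have mixed_iff: "mixed v {v, u, w} \<longleftrightarrow> ((v, u) \<in> E \<longleftrightarrow> (v, w) \<notin> E)"
    if "u \<noteq> v" "w \<noteq> v" for v u w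
    using that by (auto simp: mixed_def)
  have perm: "{b, a, c} = S" "{c, a, b} = S" using S(1) by auto
  have "mixed a S \<longleftrightarrow> ((a, b) \<in> E \<longleftrightarrow> (a, c) \<notin> E)"
    "mixed b S \<longleftrightarrow> ((b, a) \<in> E \<longleftrightarrow> (b, c) \<notin> E)"
    "mixed c S \<longleftrightarrow> ((c, a) \<in> E \<longleftrightarrow> (c, b) \<notin> E)"
    using mixed_iff[of b a c] mixed_iff[of a b c] mixed_iff[of a c b] S(2-4)
    unfolding S(1)[symmetric] perm by simp_all
  then have "\<not> (mixed a S \<and> mixed b S \<and> mixed c S)"
    using adj_sym[of a b] adj_sym[of b c] adj_sym[of a c] by blast
  moreover have "{v. mixed v S} \<subseteq> S" by (simp add: mixed_def subset_iff)
  moreover have "a \<in> S" "b \<in> S" "c \<in> S" using S(1) by auto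
  ultimately have "{v. mixed v S} \<subset> S" by blast
  then have "card {v. mixed v S} < card S"
    by (rule psubset_card_mono[rotated]) (simp add: S(1))
  then show ?thesis using assms by simp
qed

text \<open>A neighbour \<open>u\<close> and a non-neighbour \<open>w\<close> of \<open>v\<close>
  give the mixed triple \<open>{v, u, w}\<close>, from which both are recovered by intersecting with
  the neighbourhood of \<open>v\<close> and with its complement.\<close>

lemma card_mixed_triples_ge:
  assumes fin: "finite V" and v: "v \<in> V"
  shows "card (nbrs V v) * (card V - 1 - card (nbrs V v)) \<le> card {S. S \<subseteq> V \<and> card S = 3 \<and> mixed v S}"
proof -
  let ?P = "nbrs V v \<times> (V - {v} - nbrs V v)"
  have "inj_on (\<lambda>(u, w). {v, u, w}) ?P"
  proof (rule inj_onI)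
    fix p q assume "p \<in> ?P" "q \<in> ?P" and im: "(\<lambda>(u, w). {v, u, w}) p = (\<lambda>(u, w). {v, u, w}) q"
    then obtain u w u' w' where pq: "p = (u, w)" "q = (u', w')"
      and "u \<in> nbrs V v" "w \<notin> nbrs V v" "w \<noteq> v" "u' \<in> nbrs V v" "w' \<notin> nbrs V v" "w' \<noteq> v"
      by auto
    moreover have "v \<notin> nbrs V v" by (simp add: nbrs_def)
    ultimately have "{v, u, w} \<inter> nbrs V v = {u}" "{v, u, w} - nbrs V v - {v} = {w}"
      "{v, u', w'} \<inter> nbrs V v = {u'}" "{v, u', w'} - nbrs V v - {v} = {w'}" by blast+
    then show "p = q" using im by (simp add: pq)
  qed
  then have "card ((\<lambda>(u, w). {v, u, w}) ` ?P) = card ?P" by (rule card_image)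
  moreover have "(\<lambda>(u, w). {v, u, w}) ` ?P \<subseteq> {S. S \<subseteq> V \<and> card S = 3 \<and> mixed v S}"
  proof (rule image_subsetI)
    fix p assume "p \<in> ?P"
    then obtain u w where p: "p = (u, w)" and uw: "u \<in> nbrs V v" "w \<in> V" "w \<notin> nbrs V v" "w \<noteq> v"
      by auto
    then have "u \<noteq> v" "u \<noteq> w" by (auto simp: nbrs_def)
    with uw v show "(\<lambda>(u, w). {v, u, w}) p \<in> {S. S \<subseteq> V \<and> card S = 3 \<and> mixed v S}"
      by (auto simp: p nbrs_def mixed_def)
  qed
  ultimately have "card ?P \<le> card {S. S \<subseteq> V \<and> card S = 3 \<and> mixed v S}"
    using card_mono[of "{S. S \<subseteq> V \<and> card S = 3 \<and> mixed v S}" "(\<lambda>(u, w). {v, u, w}) ` ?P"] fin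
    by simp
  then show ?thesis unfolding card_cartesian_product card_non_nbrs[OF assms] .
qed

text \<open>Goodman's argument: a triple that is neither independent nor a triangle has exactly two
  vertices that are adjacent to exactly one of the other two.\<close>

lemma indep_triples_goodman:
  assumes fin: "finite V"
  shows "2 * card (indep_sets V 3) + (\<Sum>v\<in>V. card (nbrs V v) * (card V - 1 - card (nbrs V v)))
    \<le> 2 * (card V choose 3)"
proof -
  let ?T = "{S. S \<subseteq> V \<and> card S = 3}"
  have finT: "finite ?T" using fin by simp
  have sub: "indep_sets V 3 \<subseteq> ?T" by (auto simp: indep_sets_def)
  have "(\<Sum>v\<in>V. card (nbrs V v) * (card V - 1 - card (nbrs V v))) \<le> (\<Sum>v\<in>V. card {S\<in>?T. mixed v S})"
    using card_mixed_triples_ge[OF fin] by (intro sum_mono) (simp add: conj_assoc)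
  also have "\<dots> = (\<Sum>S\<in>?T. card {v\<in>V. mixed v S})"
    by (rule sum_multicount_gen) (use fin in auto)
  \<comment> \<open>Independent triples contain no edge, hence no mixed vertex, and drop out of the
    sum.\<close>
  also have "\<dots> = (\<Sum>S\<in>?T - indep_sets V 3. card {v\<in>V. mixed v S})"
    by (rule sum.mono_neutral_right[OF finT])
      (use fin in \<open>auto simp: indep_sets_def edge_free_def mixed_def\<close>)
  also have "\<dots> \<le> (\<Sum>S\<in>?T - indep_sets V 3. 2)"
  proof (rule sum_mono)
    fix S assume S: "S \<in> ?T - indep_sets V 3"
    then have "{v\<in>V. mixed v S} = {v. mixed v S}" by (auto simp: mixed_def)
    then show "card {v\<in>V. mixed v S} \<le> 2" using card_mixed_le S by auto
  qed
  also have "\<dots> = 2 * (card ?T - card (indep_sets V 3))"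
    using sub finT by (simp add: card_Diff_subset finite_subset)
  finally show ?thesis
    using card_mono[OF finT sub] n_subsets[OF fin, of 3] by simp
qed

text \<open>The product \<open>x * (n - 1 - x)\<close> is concave in \<open>x\<close>, so on the
  range from \<open>d\<close> to \<open>n - 1 - d\<close> it is least at the ends.\<close>

lemma indep_triples_le_if_degrees_between:
  assumes fin: "finite V" and deg: "min_deg_ge V d"
    and up: "\<And>v. v \<in> V \<Longrightarrow> card (nbrs V v) \<le> card V - 1 - d"
  shows "2 * card (indep_sets V 3) + card V * (d * (card V - 1 - d)) \<le> 2 * (card V choose 3)"
proof -
  have "d * (card V - 1 - d) \<le> card (nbrs V v) * (card V - 1 - card (nbrs V v))" if v: "v \<in> V" for v
  proof -
    obtain x where x: "card (nbrs V v) = d + x"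
      using deg v le_Suc_ex[of d "card (nbrs V v)"] by (auto simp: min_deg_ge_def)
    show ?thesis
    proof (cases "x = 0")
      case False
      \<comment> \<open>The claim becomes \<open>d * (d + x + y) \<le> (d + x) * (d + y)\<close>,
        with difference \<open>x * y\<close>. As \<open>x > 0\<close>, the number
        \<open>card V - 1 - d\<close> is positive and thus a true difference.\<close>
      then obtain y where y: "card V - 1 - d = d + x + y"
        using up[OF v] x le_Suc_ex by metis
      then have "card V - 1 - (d + x) = d + y" by simp
      with x y show ?thesis by (simp add: algebra_simps)
    qed (simp add: x)
  qed
  then have "card V * (d * (card V - 1 - d)) \<le> (\<Sum>v\<in>V. card (nbrs V v) * (card V - 1 - card (nbrs V v)))"
    using sum_bounded_below[of V "d * (card V - 1 - d)"] by simp
  then show ?thesis using indep_triples_goodman[OF fin] by linarith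
qed

lemma indep_triples_delete_le:
  assumes "finite V" "a \<in> V"
  shows "card (indep_sets V 3) \<le>
    card (indep_sets (V - {a}) 3) + ((card V - 1 - card (nbrs V a)) choose 2)"
proof -
  have "Suc 2 = 3" by simp
  then show ?thesis using card_indep_sets_delete_le[OF assms, of 2] by (simp only:)
qed

text \<open>A vertex adjacent to all others lies in no independent triple. Without one, the Goodman
  bound on six times the number of triples is below the target by
  \<open>3 * (n - 2)\<close>.\<close>

lemma indep_triples_min_deg_1:
  assumes fin: "finite V" and deg: "min_deg_ge V 1" and n: "4 \<le> card V"
  shows "card (indep_sets V 3) \<le> (card V - 1) choose 3 \<and>
    (card (indep_sets V 3) = (card V - 1) choose 3 \<longrightarrow>
      (\<exists>B\<subseteq>V. edge_free B \<and> card B = card V - 1))"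
proof (cases "\<exists>a\<in>V. card V - 1 \<le> card (nbrs V a)")
  case True
  then obtain a where a: "a \<in> V" "card V - 1 \<le> card (nbrs V a)" by auto
  have fa: "finite (V - {a})" and ca: "card (V - {a}) = card V - 1" using fin a by auto
  have le: "card (indep_sets V 3) \<le> card (indep_sets (V - {a}) 3)"
    using indep_triples_delete_le[OF fin a(1)] a(2) by (simp add: binomial_eq_0)
  have del: "card (indep_sets (V - {a}) 3) \<le> (card V - 1) choose 3"
    using indep_sets_le_choose[OF fa] ca by metis
  have "\<exists>B\<subseteq>V. edge_free B \<and> card B = card V - 1"
    if "card (indep_sets V 3) = (card V - 1) choose 3"
    using edge_free_if_indep_sets_eq_choose[OF fa, of 3] that le del ca n
    by (intro exI[of _ "V - {a}"]) auto
  then show ?thesis using le del by auto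
next
  case False
  then have up: "card (nbrs V v) \<le> card V - 1 - 1" if "v \<in> V" for v using that by force
  obtain k where k: "card V = 4 + k" using n le_Suc_ex by blast
  have "6 * card (indep_sets V 3) < 6 * ((card V - 1) choose 3)"
    using indep_triples_le_if_degrees_between[OF fin deg up] choose_3_times_6[of "card V"]
      choose_3_times_6[of "card V - 1"] by (simp add: k algebra_simps)
  then show ?thesis by simp
qed

text \<open>A vertex with at most one non-neighbour lies in no independent triple, and deleting it
  lowers both \<open>n\<close> and \<open>d\<close> by one, so \<open>n - d\<close> is unchanged.
  Otherwise the Goodman margin is \<open>6 * (n - 4)\<close>.\<close>

lemma indep_triples_min_deg_2:
  assumes fin: "finite V" and deg: "min_deg_ge V 2" and n: "5 \<le> card V"
  shows "card (indep_sets V 3) \<le> (card V - 2) choose 3 \<and>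
    (card (indep_sets V 3) = (card V - 2) choose 3 \<longrightarrow>
      (\<exists>B\<subseteq>V. edge_free B \<and> card B = card V - 2))"
proof (cases "\<exists>a\<in>V. card V - 2 \<le> card (nbrs V a)")
  case True
  then obtain a where a: "a \<in> V" "card V - 2 \<le> card (nbrs V a)" by auto
  have fa: "finite (V - {a})" and ca: "card (V - {a}) = card V - 1" using fin a by auto
  have "(card V - 1 - card (nbrs V a)) choose 2 = 0" using a(2) by (simp add: binomial_eq_0)
  then have le: "card (indep_sets V 3) \<le> card (indep_sets (V - {a}) 3)"
    using indep_triples_delete_le[OF fin a(1)] by linarith
  have "min_deg_ge (V - {a}) 1" using min_deg_ge_delete[OF fin, of 1] deg by (simp add: numeral_2_eq_2)
  from indep_triples_min_deg_1[OF fa this] have del: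
    "card (indep_sets (V - {a}) 3) \<le> (card V - 2) choose 3"
    "card (indep_sets (V - {a}) 3) = (card V - 2) choose 3 \<longrightarrow>
      (\<exists>B\<subseteq>V - {a}. edge_free B \<and> card B = card V - 2)"
    using n by (auto simp: ca numeral_2_eq_2)
  have "card (indep_sets (V - {a}) 3) = (card V - 2) choose 3"
    if "card (indep_sets V 3) = (card V - 2) choose 3"
    using that le del(1) by linarith
  then show ?thesis using le del by auto
next
  case False
  then have up: "card (nbrs V v) \<le> card V - 1 - 2" if "v \<in> V" for v using that by force
  obtain k where k: "card V = 5 + k" using n le_Suc_ex by blast
  have "6 * card (indep_sets V 3) < 6 * ((card V - 2) choose 3)"
    using indep_triples_le_if_degrees_between[OF fin deg up] choose_3_times_6[of "card V"]
      choose_3_times_6[of "card V - 2"] by (simp add: k algebra_simps)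
  then show ?thesis by simp
qed

text \<open>The summand 1 is the left part of the complete bipartite graph, itself a triple. A
  vertex with at most two non-neighbours lies in at most one independent triple, and deleting it
  leads to minimum degree 2.\<close>

lemma indep_triples_min_deg_3:
  assumes fin: "finite V" and deg: "min_deg_ge V 3" and n: "6 \<le> card V"
  shows "card (indep_sets V 3) \<le> ((card V - 3) choose 3) + 1 \<and>
    (card (indep_sets V 3) = ((card V - 3) choose 3) + 1 \<longrightarrow>
      (\<exists>B\<subseteq>V. edge_free B \<and> card B = card V - 3 \<and> edge_free (V - B)))"
proof (cases "\<exists>a\<in>V. card V - 3 \<le> card (nbrs V a)")
  case True
  then obtain a where a: "a \<in> V" "card V - 3 \<le> card (nbrs V a)" by auto
  have fa: "finite (V - {a})" and ca: "card (V - {a}) = card V - 1" using fin a by auto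
  have "(card V - 1 - card (nbrs V a)) choose 2 \<le> 2 choose 2"
    using a(2) by (intro binomial_right_mono) simp
  then have le: "card (indep_sets V 3) \<le> card (indep_sets (V - {a}) 3) + 1"
    using indep_triples_delete_le[OF fin a(1)] by simp
  have "min_deg_ge (V - {a}) 2" using min_deg_ge_delete[OF fin, of 2] deg by (simp add: numeral_3_eq_3)
  from indep_triples_min_deg_2[OF fa this] have del:
    "card (indep_sets (V - {a}) 3) \<le> (card V - 3) choose 3"
    "card (indep_sets (V - {a}) 3) = (card V - 3) choose 3 \<longrightarrow>
      (\<exists>B\<subseteq>V - {a}. edge_free B \<and> card B = card V - 3)"
    using n by (auto simp: ca numeral_3_eq_3 numeral_2_eq_2)
  have "\<exists>B\<subseteq>V. edge_free B \<and> card B = card V - 3 \<and> edge_free (V - B)"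
    if eq: "card (indep_sets V 3) = ((card V - 3) choose 3) + 1"
  proof -
    obtain B where B: "B \<subseteq> V" "edge_free B" "card B = card V - 3"
      using eq le del by auto
    \<comment> \<open>The triples inside \<open>B\<close> fall one short of equality, so the three
      vertices of \<open>V - B\<close> must be independent.\<close>
    have "card (indep_sets (V - B) 3) \<ge> 1"
      using indep_sets_le_if_edge_free[OF fin deg B, of 3] n eq by simp
    then obtain S where S: "S \<in> indep_sets (V - B) 3" by (metis One_nat_def card.empty ex_in_conv not_less_eq_eq zero_le)
    have "card (V - B) = 3" using B fin n by (simp add: card_Diff_subset finite_subset)
    then have "S = V - B"
      using S fin by (intro card_subset_eq) (auto simp: indep_sets_def)
    with S B show ?thesis by (auto simp: indep_sets_def)
  qed
  then show ?thesis using le del by auto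
next
  case False
  then have up: "card (nbrs V v) \<le> card V - 1 - 3" if "v \<in> V" for v using that by force
  obtain v where v: "v \<in> V" using n by fastforce
  with deg have "3 \<le> card (nbrs V v)" by (simp add: min_deg_ge_def)
  \<comment> \<open>The Goodman margin is \<open>9 * (n - 6)\<close>, so strictness requires
    excluding \<open>n = 6\<close>; the degree bounds \<open>3\<close> and \<open>n - 4\<close> do
    so.\<close>
  then have "7 \<le> card V" using up[OF v] by linarith
  then obtain k where k: "card V = 7 + k" using le_Suc_ex by blast
  have "6 * card (indep_sets V 3) < 6 * ((card V - 3) choose 3) + 6"
    using indep_triples_le_if_degrees_between[OF fin deg up] choose_3_times_6[of "card V"]
      choose_3_times_6[of "card V - 3"] by (simp add: k algebra_simps)
  then show ?thesis by simp
qed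

text \<open>For \<open>t > t0\<close>, equality at \<open>t\<close> together with the mere bound at
  \<open>t - 1\<close> already forces the structure.\<close>

lemma edge_free_if_indep_sets_eq_choose_min_deg:
  assumes fin: "finite V" and deg: "min_deg_ge V d" and t: "2 \<le> t0" "t0 \<le> t" "t \<le> card V - d"
    and base: "card (indep_sets V t0) \<le> (card V - d) choose t0"
      "card (indep_sets V t0) = (card V - d) choose t0 \<longrightarrow>
        (\<exists>B\<subseteq>V. edge_free B \<and> card B = card V - d)"
    and eq: "card (indep_sets V t) = (card V - d) choose t"
  shows "\<exists>B\<subseteq>V. edge_free B \<and> card B = card V - d"
proof (cases "t = t0")
  case False
  then obtain s where s: "t = Suc s" "t0 \<le> s" using t by (cases t) auto
  have "card (indep_sets V s) \<le> (card V - d) choose s"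
    using indep_sets_le_choose_mono[OF fin deg _ s(2) base(1)] t by simp
  then show ?thesis
    using edge_free_if_indep_sets_Suc_eq_choose[OF fin deg, of s] s t eq by (metis le_trans order_refl)
qed (use base eq in simp)

text \<open>The triple bound is one too large to start the propagation. If that excess is attained,
  the graph is known and the three vertices of \<open>V - B\<close> contain no quadruple; otherwise
  the propagation starts at 3.\<close>

lemma indep_quadruples_min_deg_3:
  assumes fin: "finite V" and deg: "min_deg_ge V 3" and n: "7 \<le> card V"
  shows "card (indep_sets V 4) \<le> (card V - 3) choose 4 \<and>
    (card (indep_sets V 4) = (card V - 3) choose 4 \<longrightarrow>
      (\<exists>B\<subseteq>V. edge_free B \<and> card B = card V - 3))"
proof (cases "card (indep_sets V 3) \<le> (card V - 3) choose 3")
  case True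
  then have "card (indep_sets V 4) \<le> (card V - 3) choose 4"
    using indep_sets_le_choose_mono[OF fin deg _ _ True, of 4] by simp
  moreover have "\<exists>B\<subseteq>V. edge_free B \<and> card B = card V - 3"
    if eq: "card (indep_sets V 4) = (card V - 3) choose 4"
    by (rule edge_free_if_indep_sets_Suc_eq_choose[OF fin deg _ True]) (use n eq in auto)
  ultimately show ?thesis by blast
next
  case False
  then have "\<exists>B\<subseteq>V. edge_free B \<and> card B = card V - 3 \<and> edge_free (V - B)"
    using indep_triples_min_deg_3[OF fin deg] n by auto
  then obtain B where B: "B \<subseteq> V" "edge_free B" "card B = card V - 3" by blast
  have "card (V - B) = 3" using B fin n by (simp add: card_Diff_subset finite_subset)
  then have "card (indep_sets (V - B) 4) = 0"
    using indep_sets_le_choose[of "V - B" 4] fin by (simp add: binomial_eq_0)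
  then show ?thesis using indep_sets_le_if_edge_free[OF fin deg B, of 4] n B by auto
qed

end

subsection \<open>Transfer along graph isomorphisms\<close>

text \<open>A digraph isomorphism carries a separate map on arcs; since arcs are pairs of vertices
  here, the vertex map determines it.\<close>

lemma graph_iso_iff:
  assumes "pair_wf_digraph G"
  shows "graph_iso G H \<longleftrightarrow>
    (\<exists>f. inj_on f (pverts G) \<and> pverts H = f ` pverts G \<and> parcs H = map_prod f f ` parcs G)"
proof
  assume "graph_iso G H"
  then obtain h where h: "pre_digraph.digraph_isomorphism (with_proj G) h"
    and H: "with_proj H = app_iso h (with_proj G)"
    by (auto simp: graph_iso_def digraph_iso_def)
  let ?f = "iso_verts h"
  have inj: "inj_on ?f (pverts G)" using h by (simp add: pre_digraph.digraph_isomorphism_def)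
  have V: "pverts H = ?f ` pverts G" and A: "parcs H = iso_arcs h ` parcs G"
    and ends: "iso_tail h = fst" "iso_head h = snd"
    using arg_cong[OF H, of verts] arg_cong[OF H, of arcs] arg_cong[OF H, of tail] arg_cong[OF H, of head]
    by simp_all
  have "iso_arcs h e = map_prod ?f ?f e" if "e \<in> parcs G" for e
    using h that ends by (auto simp: pre_digraph.digraph_isomorphism_def prod_eq_iff)
  then have "parcs H = map_prod ?f ?f ` parcs G" unfolding A by (rule image_cong[OF refl])
  with inj V show "\<exists>f. inj_on f (pverts G) \<and> pverts H = f ` pverts G \<and> parcs H = map_prod f f ` parcs G"
    by blast
next
  interpret pair_wf_digraph G by fact
  assume "\<exists>f. inj_on f (pverts G) \<and> pverts H = f ` pverts G \<and> parcs H = map_prod f f ` parcs G"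
  then obtain f where f: "inj_on f (pverts G)" "pverts H = f ` pverts G" "parcs H = map_prod f f ` parcs G"
    by blast
  let ?h = "\<lparr>iso_verts = f, iso_arcs = map_prod f f, iso_head = snd, iso_tail = fst\<rparr>"
  have "parcs G \<subseteq> pverts G \<times> pverts G" using in_arcsD1 in_arcsD2 by auto
  then have "inj_on (map_prod f f) (parcs G)"
    using map_prod_inj_on[OF f(1) f(1)] inj_on_subset by blast
  then have "digraph_isomorphism ?h"
    using f wf_digraph_axioms by (simp add: digraph_isomorphism_def)
  moreover have "with_proj H = app_iso ?h (with_proj G)"
    using f by (simp add: app_iso_def with_proj_def)
  ultimately show "graph_iso G H" unfolding graph_iso_def digraph_iso_def by blast
qed

lemma num_indep_graph_iso:
  assumes "pair_wf_digraph G" "graph_iso G H"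
  shows "num_indep t G = num_indep t H"
proof -
  interpret pair_wf_digraph G by fact
  obtain f where f: "inj_on f (pverts G)" "pverts H = f ` pverts G" "parcs H = map_prod f f ` parcs G"
    using assms(2) unfolding graph_iso_iff[OF assms(1)] by blast
  have arc: "(f u, f v) \<in> parcs H \<longleftrightarrow> (u, v) \<in> parcs G" if "u \<in> pverts G" "v \<in> pverts G" for u v
  proof
    assume "(f u, f v) \<in> parcs H"
    then obtain x y where "(x, y) \<in> parcs G" "f u = f x" "f v = f y" using f by auto
    moreover from this have "x \<in> pverts G" "y \<in> pverts G" using in_arcsD1 in_arcsD2 by auto
    ultimately show "(u, v) \<in> parcs G" using f(1) that by (metis inj_onD)
  qed (use f in force)
  have iff: "independent_set H (f ` S) \<longleftrightarrow> independent_set G S" if "S \<subseteq> pverts G" for S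
  proof -
    have "f ` S \<subseteq> pverts H" using that f(2) by auto
    moreover have "(\<forall>x\<in>f ` S. \<forall>y\<in>f ` S. (x, y) \<notin> parcs H) \<longleftrightarrow> (\<forall>u\<in>S. \<forall>v\<in>S. (u, v) \<notin> parcs G)"
      using that arc by (simp add: subset_iff)
    ultimately show ?thesis using that by (simp add: independent_set_def)
  qed
  have "{S. independent_set H S \<and> card S = t} = (`) f ` {S. independent_set G S \<and> card S = t}"
  proof (intro equalityI subsetI)
    fix S assume S: "S \<in> {S. independent_set H S \<and> card S = t}"
    then obtain T where T: "T \<subseteq> pverts G" "S = f ` T"
      using f(2) by (auto simp: independent_set_def subset_image_iff)
    then show "S \<in> (`) f ` {S. independent_set G S \<and> card S = t}"
      using S iff card_image[OF inj_on_subset[OF f(1) T(1)]] by auto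
  next
    fix S assume "S \<in> (`) f ` {S. independent_set G S \<and> card S = t}"
    then obtain T where T: "independent_set G T" "card T = t" "S = f ` T" by auto
    then have sub: "T \<subseteq> pverts G" by (simp add: independent_set_def)
    then show "S \<in> {S. independent_set H S \<and> card S = t}"
      using T iff card_image[OF inj_on_subset[OF f(1) sub]] by auto
  qed
  moreover have "inj_on ((`) f) {S. independent_set G S \<and> card S = t}"
    by (rule inj_on_subset[OF inj_on_image_Pow[OF f(1)]]) (auto simp: independent_set_def)
  ultimately show ?thesis by (simp add: num_indep_def card_image)
qed

text \<open>No \<open>t\<close>-set fits into the left part when \<open>a < t\<close>, so the added
  edges destroy nothing that was counted.\<close>

lemma num_indep_add_edges_left:
  assumes F: "F \<subseteq> left_part a \<times> left_part a" and t: "a < t"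
  shows "num_indep t (add_edges (complete_bipartite a b) F) = b choose t"
proof -
  have "independent_set (add_edges (complete_bipartite a b) F) S \<longleftrightarrow> S \<subseteq> right_part b"
    if S: "card S = t" for S
  proof
    assume "independent_set (add_edges (complete_bipartite a b) F) S"
    then have "independent_set (complete_bipartite a b) S"
      by (auto simp: independent_set_def add_edges_def)
    moreover have "\<not> S \<subseteq> left_part a"
      using card_mono[of "left_part a" S] S t by auto
    ultimately show "S \<subseteq> right_part b" by (simp add: independent_set_complete_bipartite)
  next
    assume R: "S \<subseteq> right_part b"
    then have "independent_set (complete_bipartite a b) S" by (simp add: independent_set_complete_bipartite)
    moreover have "u \<notin> left_part a" if "u \<in> S" for u
      using that R parts_disjoint by blast
    then have "(u, v) \<notin> F \<union> F\<inverse>" if "u \<in> S" for u v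
      using that F by blast
    ultimately show "independent_set (add_edges (complete_bipartite a b) F) S"
      by (auto simp: independent_set_def add_edges_def)
  qed
  then have "{S. independent_set (add_edges (complete_bipartite a b) F) S \<and> card S = t} =
      {S. S \<subseteq> right_part b \<and> card S = t}" by auto
  then show ?thesis by (simp add: num_indep_def n_subsets)
qed

lemma add_edges_cong: "F \<union> F\<inverse> = F' \<union> F'\<inverse> \<Longrightarrow> add_edges G F = add_edges G F'"
  by (simp add: add_edges_def Un_assoc)

lemma add_edges_empty: "add_edges G {} = G"
  by (simp add: add_edges_def)

text \<open>\<open>F\<close> may contain either or both orientations of the only possible edge;
  \<open>add_edges\<close> symmetrises them to the same graph.\<close>

lemma add_edges_left_part_2_cases:
  assumes "F \<subseteq> left_part 2 \<times> left_part 2 - Id"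
  shows "add_edges G F = G \<or> add_edges G F = add_edges G {(Inl 0, Inl 1)}"
proof (cases "F = {}")
  case False
  have L: "left_part 2 = {Inl 0, Inl 1}"
    by (auto simp: left_part_def lessThan_Suc numeral_2_eq_2)
  have "F \<subseteq> {(Inl 0, Inl 1), (Inl 1, Inl 0)}" using assms unfolding L by auto
  with False have "F \<union> F\<inverse> = {(Inl 0, Inl 1)} \<union> {(Inl 0, Inl 1)}\<inverse>" by auto
  then show ?thesis using add_edges_cong by blast
qed (simp add: add_edges_empty)

section \<open>From graphs to \<open>adjacency\<close>, and recognition of the extremal
  graphs\<close>

locale nonempty_graph = pair_graph +
  assumes pverts_nonempty: "pverts G \<noteq> {}"
begin

sublocale adjacency "parcs G"
proof
  show "sym (parcs G)" using arcs_symmetric by (auto intro: symI)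
  show "irrefl (parcs G)" using no_loops' by (auto simp: irrefl_def)
qed

lemma num_indep_eq: "num_indep t G = card (indep_sets (pverts G) t)"
  by (simp add: num_indep_def indep_sets_def independent_set_def edge_free_def conj_ac)

lemma card_nbrs_pverts: "card (nbrs (pverts G) v) = out_degree (with_proj G) v"
proof -
  have "out_arcs (with_proj G) v = Pair v ` nbrs (pverts G) v"
    using in_arcsD2 by (auto simp: nbrs_def out_arcs_def)
  then show ?thesis by (simp add: out_degree_def card_image inj_on_def)
qed

lemma min_deg_ge_min_degree: "min_deg_ge (pverts G) (min_degree G)"
  unfolding min_deg_ge_def card_nbrs_pverts min_degree_def by simp

lemma min_degree_less_card: "min_degree G < card (pverts G)"
proof -
  obtain v where v: "v \<in> pverts G" using pverts_nonempty by auto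
  have "v \<notin> nbrs (pverts G) v" by (simp add: nbrs_def)
  then have "nbrs (pverts G) v \<subset> pverts G" using v nbrs_subset by blast
  then have "card (nbrs (pverts G) v) < card (pverts G)" by (intro psubset_card_mono) simp_all
  then show ?thesis using min_deg_ge_min_degree v by (auto simp: min_deg_ge_def)
qed

text \<open>Each vertex of \<open>B\<close> is adjacent to exactly the complement \<open>A\<close>
  of \<open>B\<close>, so any bijections from \<open>A\<close> to the left part and from
  \<open>B\<close> to the right part combine to an isomorphism. \<open>F\<close> is the image of the
  arcs inside \<open>A\<close>; the last clause singles out the plain complete bipartite
  graph.\<close>

lemma graph_iso_add_edges_left:
  assumes B: "B \<subseteq> pverts G" "edge_free B" "card B = card (pverts G) - min_degree G"
  obtains F where "F \<subseteq> left_part (min_degree G) \<times> left_part (min_degree G) - Id"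
    "graph_iso G (add_edges (complete_bipartite (min_degree G) (card (pverts G) - min_degree G)) F)"
    "edge_free (pverts G - B) \<Longrightarrow> F = {}"
proof -
  let ?d = "min_degree G" and ?n = "card (pverts G)"
  let ?L = "left_part ?d" and ?R = "right_part (?n - ?d)"
  define A where "A = pverts G - B"
  have d: "?d \<le> ?n" using min_degree_less_card by simp
  have cA: "card A = ?d" unfolding A_def using B d by (simp add: card_Diff_subset finite_subset)
  have fins: "finite A" "finite B" using B(1) by (auto simp: A_def intro: finite_subset)
  obtain g where g: "bij_betw g A ?L"
    using finite_same_card_bij[of A ?L] fins cA by auto
  obtain h where h: "bij_betw h B ?R"
    using finite_same_card_bij[of B ?R] fins B by auto
  define f where "f x = (if x \<in> A then g x else h x)" for x
  have fA: "f ` A = ?L" and injA: "inj_on f A"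
    using g by (auto simp: f_def bij_betw_def inj_on_def)
  have notA: "x \<notin> A" if "x \<in> B" for x using that by (simp add: A_def)
  then have fB: "f ` B = ?R" and injB: "inj_on f B"
    using h by (auto simp: f_def bij_betw_def inj_on_def)
  have V: "pverts G = A \<union> B" using B by (auto simp: A_def)
  have inj: "inj_on f (A \<union> B)"
  proof -
    have "f ` (A - B) \<inter> f ` (B - A) \<subseteq> ?L \<inter> ?R" unfolding fA[symmetric] fB[symmetric] by blast
    then show ?thesis using injA injB parts_disjoint[of ?d "?n - ?d"] by (auto simp: inj_on_Un)
  qed
  have nb: "nbrs (pverts G) b = A" if "b \<in> B" for b
    using nbrs_eq_Diff[OF _ min_deg_ge_min_degree B d that] by (simp add: A_def)
  have BA: "(b, a) \<in> parcs G \<longleftrightarrow> a \<in> A" if "b \<in> B" for a b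
    using nb[OF that] in_arcsD2[of b a] by (auto simp: nbrs_def)
  have arcs: "parcs G = A \<times> B \<union> B \<times> A \<union> (parcs G \<inter> A \<times> A)"
  proof (intro equalityI subsetI)
    fix e assume e: "e \<in> parcs G"
    then obtain u v where uv: "e = (u, v)" "u \<in> A \<union> B" "v \<in> A \<union> B"
      using in_arcsD1 in_arcsD2 V by (cases e) auto
    then show "e \<in> A \<times> B \<union> B \<times> A \<union> (parcs G \<inter> A \<times> A)"
      using e BA notA by blast
  qed (use BA adj_sym in blast)
  let ?F = "map_prod f f ` (parcs G \<inter> A \<times> A)"
  have prod: "map_prod f f ` (X \<times> Y) = f ` X \<times> f ` Y" for X Y by auto
  have "map_prod f f ` parcs G = map_prod f f ` (A \<times> B \<union> B \<times> A \<union> (parcs G \<inter> A \<times> A))"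
    using arcs by (rule arg_cong)
  also have "\<dots> = ?L \<times> ?R \<union> ?R \<times> ?L \<union> ?F" by (simp only: image_Un prod fA fB)
  also have "\<dots> = ?L \<times> ?R \<union> ?R \<times> ?L \<union> ?F \<union> ?F\<inverse>"
  proof -
    have "?F\<inverse> = ?F" using adj_sym by (force simp: image_iff)
    then show ?thesis by blast
  qed
  finally have arcsH: "map_prod f f ` parcs G = ?L \<times> ?R \<union> ?R \<times> ?L \<union> ?F \<union> ?F\<inverse>" .
  show thesis
  proof (rule that)
    show "?F \<subseteq> ?L \<times> ?L - Id"
    proof
      fix e assume "e \<in> ?F"
      then obtain u v where uv: "e = (f u, f v)" "(u, v) \<in> parcs G" "u \<in> A" "v \<in> A" by auto
      then have "u \<noteq> v" by auto
      then have "f u \<noteq> f v" using injA uv by (auto dest: inj_onD)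
      then show "e \<in> ?L \<times> ?L - Id" using uv fA by auto
    qed
    show "graph_iso G (add_edges (complete_bipartite ?d (?n - ?d)) ?F)"
      unfolding graph_iso_iff[OF pair_wf_digraph_axioms]
      using inj V arcsH fA fB
      by (intro exI[of _ f]) (auto simp: add_edges_def complete_bipartite_def)
    show "edge_free (pverts G - B) \<Longrightarrow> ?F = {}"
      by (auto simp: edge_free_def A_def)
  qed
qed

lemma num_indep_eq_if_bipartite_plus_left_edges:
  assumes "bipartite_plus_left_edges a b G" "a < t"
  shows "num_indep t G = num_indep t (complete_bipartite a b)"
proof -
  obtain F where F: "F \<subseteq> left_part a \<times> left_part a - Id"
    "graph_iso G (add_edges (complete_bipartite a b) F)"
    using assms by (auto simp: bipartite_plus_left_edges_def)
  have "num_indep t G = b choose t"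
    using num_indep_graph_iso[OF pair_wf_digraph_axioms F(2)] num_indep_add_edges_left[of F a t b] F assms(2)
    by auto
  then show ?thesis using assms(2) by (simp add: num_indep_complete_bipartite binomial_eq_0)
qed

lemma bipartite_plus_left_edges_if_edge_free:
  assumes "\<exists>B\<subseteq>pverts G. edge_free B \<and> card B = card (pverts G) - min_degree G"
  shows "bipartite_plus_left_edges (min_degree G) (card (pverts G) - min_degree G) G"
proof -
  obtain B where "B \<subseteq> pverts G" "edge_free B" "card B = card (pverts G) - min_degree G"
    using assms by blast
  then show ?thesis
    using graph_iso_add_edges_left unfolding bipartite_plus_left_edges_def by metis
qed

text \<open>Reduces each case to a single size \<open>t0\<close>. With fewer than
  \<open>t0 + min_degree G\<close> vertices there are no independent \<open>t0\<close>-sets, hence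
  the guard on \<open>base\<close>; \<open>min_degree G < t0\<close> makes the left part contribute
  nothing to the count in \<open>K\<close>.\<close>

lemma extremal_if_base_case:
  fixes t :: nat
  assumes t: "2 \<le> t0" "t0 \<le> t" "min_degree G < t0"
    and base: "t0 + min_degree G \<le> card (pverts G) \<Longrightarrow>
      card (indep_sets (pverts G) t0) \<le> (card (pverts G) - min_degree G) choose t0 \<and>
      (card (indep_sets (pverts G) t0) = (card (pverts G) - min_degree G) choose t0 \<longrightarrow>
        (\<exists>B\<subseteq>pverts G. edge_free B \<and> card B = card (pverts G) - min_degree G))"
  defines "K \<equiv> complete_bipartite (min_degree G) (card (pverts G) - min_degree G)"
  shows "num_indep t G \<le> num_indep t K \<and>
    (t \<le> card (pverts G) - min_degree G \<longrightarrow>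
      (num_indep t G = num_indep t K \<longleftrightarrow>
        bipartite_plus_left_edges (min_degree G) (card (pverts G) - min_degree G) G))"
proof -
  let ?V = "pverts G" and ?d = "min_degree G"
  have fin: "finite ?V" by simp
  note deg = min_deg_ge_min_degree
  have K: "num_indep t K = (card ?V - ?d) choose t"
    using t by (simp add: K_def num_indep_complete_bipartite binomial_eq_0)
  have le0: "card (indep_sets ?V t0) \<le> (card ?V - ?d) choose t0"
  proof (cases "t0 + ?d \<le> card ?V")
    case False
    then have "indep_sets ?V t0 = {}" using card_ge_if_indep_set[OF fin deg] t(1) by fastforce
    then show ?thesis by simp
  qed (use base in simp)
  have le: "num_indep t G \<le> num_indep t K"
    unfolding K num_indep_eq using indep_sets_le_choose_mono[OF fin deg _ t(2) le0] t(1) by simp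
  have "num_indep t G = num_indep t K \<longleftrightarrow> bipartite_plus_left_edges ?d (card ?V - ?d) G"
    if tn: "t \<le> card ?V - ?d"
  proof
    assume eq: "num_indep t G = num_indep t K"
    have "t0 + ?d \<le> card ?V" using tn t by linarith
    then show "bipartite_plus_left_edges ?d (card ?V - ?d) G"
      using edge_free_if_indep_sets_eq_choose_min_deg[OF fin deg t(1,2) tn le0] base eq
      unfolding K num_indep_eq by (intro bipartite_plus_left_edges_if_edge_free) blast
  next
    assume "bipartite_plus_left_edges ?d (card ?V - ?d) G"
    then show "num_indep t G = num_indep t K"
      unfolding K_def using t by (intro num_indep_eq_if_bipartite_plus_left_edges) auto
  qed
  with le show ?thesis by blast
qed

end

section \<open>Assembling the three ranges of minimum degree\<close>

theorem theorem1p4: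
  shows
    "(\<forall>n t. \<forall>G \<in> (graph_family n 2 :: 'a pair_pre_digraph set). t \<ge> 3 \<longrightarrow>
        num_indep t G \<le> num_indep t (complete_bipartite 2 (n - 2)) \<and>
        (n \<ge> 5 \<and> t \<le> n - 2 \<longrightarrow>
          (num_indep t G = num_indep t (complete_bipartite 2 (n - 2)) \<longleftrightarrow>
            graph_iso G (complete_bipartite 2 (n - 2)) \<or>
            graph_iso G (add_edges (complete_bipartite 2 (n - 2)) {(Inl 0, Inl 1)}))))
   \<and> (\<forall>n t. \<forall>G \<in> (graph_family n 3 :: 'a pair_pre_digraph set). t \<ge> 3 \<longrightarrow>
        num_indep t G \<le> num_indep t (complete_bipartite 3 (n - 3)) \<and>
        (n \<ge> 6 \<and> t = 3 \<longrightarrow>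
          (num_indep t G = num_indep t (complete_bipartite 3 (n - 3)) \<longleftrightarrow>
            graph_iso G (complete_bipartite 3 (n - 3)))) \<and>
        (n \<ge> 7 \<and> 4 \<le> t \<and> t \<le> n - 3 \<longrightarrow>
          (num_indep t G = num_indep t (complete_bipartite 3 (n - 3)) \<longleftrightarrow>
            bipartite_plus_left_edges 3 (n - 3) G)))
   \<and> (\<forall>\<delta> n t. \<forall>G \<in> (graph_family n \<delta> :: 'a pair_pre_digraph set).
        \<delta> \<ge> 3 \<and> t \<ge> 2 * \<delta> + 1 \<longrightarrow>
        num_indep t G \<le> num_indep t (complete_bipartite \<delta> (n - \<delta>)) \<and>
        (n \<ge> 3 * \<delta> + 1 \<and> t \<le> n - \<delta> \<longrightarrow>
          (num_indep t G = num_indep t (complete_bipartite \<delta> (n - \<delta>)) \<longleftrightarrow>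
            bipartite_plus_left_edges \<delta> (n - \<delta>) G)))"
proof (intro conjI)
  show "\<forall>n t. \<forall>G \<in> (graph_family n 2 :: 'a pair_pre_digraph set). t \<ge> 3 \<longrightarrow>
        num_indep t G \<le> num_indep t (complete_bipartite 2 (n - 2)) \<and>
        (n \<ge> 5 \<and> t \<le> n - 2 \<longrightarrow>
          (num_indep t G = num_indep t (complete_bipartite 2 (n - 2)) \<longleftrightarrow>
            graph_iso G (complete_bipartite 2 (n - 2)) \<or>
            graph_iso G (add_edges (complete_bipartite 2 (n - 2)) {(Inl 0, Inl 1)})))"
  proof (intro allI ballI impI)
    fix n t :: nat and G :: "'a pair_pre_digraph"
    assume G: "G \<in> graph_family n 2" and t: "3 \<le> t"
    let ?K = "complete_bipartite 2 (n - 2)"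
    interpret nonempty_graph G
      using G by (simp add: graph_family_def nonempty_graph_def nonempty_graph_axioms_def)
    have n: "card (pverts G) = n" and d: "min_degree G = 2" using G by (auto simp: graph_family_def)
    have "bipartite_plus_left_edges 2 (n - 2) G \<longleftrightarrow>
      graph_iso G ?K \<or> graph_iso G (add_edges ?K {(Inl 0, Inl 1)})"
    proof
      assume "bipartite_plus_left_edges 2 (n - 2) G"
      then show "graph_iso G ?K \<or> graph_iso G (add_edges ?K {(Inl 0, Inl 1)})"
        using add_edges_left_part_2_cases unfolding bipartite_plus_left_edges_def by metis
    next
      have "{(Inl 0, Inl 1)} \<subseteq> left_part 2 \<times> left_part 2 - Id" by (auto simp: left_part_def)
      moreover assume "graph_iso G ?K \<or> graph_iso G (add_edges ?K {(Inl 0, Inl 1)})"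
      ultimately show "bipartite_plus_left_edges 2 (n - 2) G"
        unfolding bipartite_plus_left_edges_def by (metis add_edges_empty empty_subsetI)
    qed
    \<comment> \<open>Start at \<open>t0 = 3\<close>; the guard \<open>t0 + 2 \<le> n\<close> is the
      hypothesis \<open>5 \<le> n\<close> of the triple bound.\<close>
    moreover have "num_indep t G \<le> num_indep t ?K \<and> (t \<le> n - 2 \<longrightarrow>
        (num_indep t G = num_indep t ?K \<longleftrightarrow> bipartite_plus_left_edges 2 (n - 2) G))"
      using extremal_if_base_case[of 3 t] indep_triples_min_deg_2[of "pverts G"] t
        min_deg_ge_min_degree by (simp add: n d)
    ultimately show "num_indep t G \<le> num_indep t ?K \<and> (n \<ge> 5 \<and> t \<le> n - 2 \<longrightarrow>
          (num_indep t G = num_indep t ?K \<longleftrightarrow>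
            graph_iso G ?K \<or> graph_iso G (add_edges ?K {(Inl 0, Inl 1)})))"
      by blast
  qed
next
  show "\<forall>n t. \<forall>G \<in> (graph_family n 3 :: 'a pair_pre_digraph set). t \<ge> 3 \<longrightarrow>
        num_indep t G \<le> num_indep t (complete_bipartite 3 (n - 3)) \<and>
        (n \<ge> 6 \<and> t = 3 \<longrightarrow>
          (num_indep t G = num_indep t (complete_bipartite 3 (n - 3)) \<longleftrightarrow>
            graph_iso G (complete_bipartite 3 (n - 3)))) \<and>
        (n \<ge> 7 \<and> 4 \<le> t \<and> t \<le> n - 3 \<longrightarrow>
          (num_indep t G = num_indep t (complete_bipartite 3 (n - 3)) \<longleftrightarrow>
            bipartite_plus_left_edges 3 (n - 3) G))"
  proof (intro allI ballI impI)
    fix n t :: nat and G :: "'a pair_pre_digraph"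
    assume G: "G \<in> graph_family n 3" and t: "3 \<le> t"
    let ?K = "complete_bipartite 3 (n - 3)"
    interpret nonempty_graph G
      using G by (simp add: graph_family_def nonempty_graph_def nonempty_graph_axioms_def)
    have n: "card (pverts G) = n" and d: "min_degree G = 3" using G by (auto simp: graph_family_def)
    have deg: "min_deg_ge (pverts G) 3" using min_deg_ge_min_degree d by simp
    show "num_indep t G \<le> num_indep t ?K \<and>
        (n \<ge> 6 \<and> t = 3 \<longrightarrow> (num_indep t G = num_indep t ?K \<longleftrightarrow> graph_iso G ?K)) \<and>
        (n \<ge> 7 \<and> 4 \<le> t \<and> t \<le> n - 3 \<longrightarrow>
          (num_indep t G = num_indep t ?K \<longleftrightarrow> bipartite_plus_left_edges 3 (n - 3) G))"
    \<comment> \<open>For \<open>t = 3\<close> the left part counts as an independent triple, so an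
      added edge would lose it; for larger \<open>t\<close> the start is
      \<open>t0 = 4\<close>.\<close>
    proof (cases "t = 3")
      case True
      have K: "num_indep 3 ?K = ((n - 3) choose 3) + 1" by (simp add: num_indep_complete_bipartite)
      have le: "num_indep 3 G \<le> num_indep 3 ?K"
      proof (cases "6 \<le> n")
        case False
        then have "indep_sets (pverts G) 3 = {}"
          using card_ge_if_indep_set[OF _ deg, of _ 3] n by fastforce
        then show ?thesis by (simp add: num_indep_eq)
      qed (use indep_triples_min_deg_3[OF _ deg] in \<open>simp add: K num_indep_eq n\<close>)
      have "num_indep 3 G = num_indep 3 ?K \<longleftrightarrow> graph_iso G ?K" if n6: "6 \<le> n"
      proof
        assume "num_indep 3 G = num_indep 3 ?K"
        then obtain B where B: "B \<subseteq> pverts G" "edge_free B" "card B = card (pverts G) - min_degree G"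
          and A: "edge_free (pverts G - B)"
          using indep_triples_min_deg_3[OF _ deg] n6 by (auto simp: K num_indep_eq n d)
        obtain F where "graph_iso G (add_edges ?K F)" "F = {}"
          using graph_iso_add_edges_left[OF B, unfolded n d] A by metis
        then show "graph_iso G ?K" by (simp add: add_edges_empty)
      qed (rule num_indep_graph_iso[OF pair_wf_digraph_axioms])
      with le True show ?thesis by simp
    next
      case False
      then show ?thesis
        using extremal_if_base_case[of 4 t] indep_quadruples_min_deg_3[OF _ deg] t by (simp add: n d)
    qed
  qed
next
  show "\<forall>\<delta> n t. \<forall>G \<in> (graph_family n \<delta> :: 'a pair_pre_digraph set).
        \<delta> \<ge> 3 \<and> t \<ge> 2 * \<delta> + 1 \<longrightarrow>
        num_indep t G \<le> num_indep t (complete_bipartite \<delta> (n - \<delta>)) \<and>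
        (n \<ge> 3 * \<delta> + 1 \<and> t \<le> n - \<delta> \<longrightarrow>
          (num_indep t G = num_indep t (complete_bipartite \<delta> (n - \<delta>)) \<longleftrightarrow>
            bipartite_plus_left_edges \<delta> (n - \<delta>) G))"
  proof (intro allI ballI impI)
    fix \<delta> n t :: nat and G :: "'a pair_pre_digraph"
    assume G: "G \<in> graph_family n \<delta>" and t: "3 \<le> \<delta> \<and> 2 * \<delta> + 1 \<le> t"
    interpret nonempty_graph G
      using G by (simp add: graph_family_def nonempty_graph_def nonempty_graph_axioms_def)
    have n: "card (pverts G) = n" and d: "min_degree G = \<delta>" using G by (auto simp: graph_family_def)
    have deg: "min_deg_ge (pverts G) \<delta>" using min_deg_ge_min_degree d by simp
    \<comment> \<open>Start at \<open>t0 = 2 * \<delta> + 1\<close>, where the guard becomes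
      \<open>3 * \<delta> + 1 \<le> n\<close>.\<close>
    show "num_indep t G \<le> num_indep t (complete_bipartite \<delta> (n - \<delta>)) \<and>
        (n \<ge> 3 * \<delta> + 1 \<and> t \<le> n - \<delta> \<longrightarrow>
          (num_indep t G = num_indep t (complete_bipartite \<delta> (n - \<delta>)) \<longleftrightarrow>
            bipartite_plus_left_edges \<delta> (n - \<delta>) G))"
      using extremal_if_base_case[of "2 * \<delta> + 1" t] indep_sets_two_min_deg_plus_one[OF _ deg] t
      by (simp add: n d)
  qed
qed

end
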